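(* Let $(X,d)$ be a metric space and let $G\leq\operatorname{Iso}(X)$ be a group of isometries of $X$, endowed with the topology of pointwise convergence. Suppose that $(X,d)$ is finitely injective and approximately $G$-ultrahomogeneous. Then the greatest equivariant compactification $\beta_G\colon X\to\beta_G X$ of the $G$-space $X$ is (equivalent to) the Gromov compactification $\gamma\colon X\to\gamma X$ of $(X,d)$.
   Context: Finitely injective: let $\operatorname{diam}(X)\in[0,\infty]$ be the diameter of $X$; $(X,d)$ is finitely injective if for every pair of finite metric spaces $K\subseteq L$ with diameter at most $\operatorname{diam}(X)$ and every isometric embedding $\phi\colon K\to X$ there is an isometric embedding $\Phi\colon L\to X$ extending $\phi$. Approximately $G$-ultrahomogeneous: for every $\varepsilon>0$ and every partial isometry $p\colon A\to B$ between finite subsets $A,B\subseteq X$ there exists $g\in G$ such that $d(p(a),ga)<\varepsilon$ for all $a\in A$. Equivariant compactifications: a $G$-space is a Tychonoff space $X$ with a continuous left action of the topological group $G$. An equivariant compactification of $X$ is a compact Hausdorff $G$-space $K$ together with a continuous $G$-equivariant map $\nu\colon X\to K$ with dense image (not necessarily injective or an embedding). A compactification $\nu'\colon X\to K'$ is a factor of $\nu\colon X\to K$ if there is a continuous map $\pi\colon K\to K'$ with $\pi\circ\nu=\nu'$; two compactifications are equivalent if each is a factor of the other. The greatest equivariant compactification $\beta_G\colon X\to\beta_GX$ is the one of which every equivariant compactification of $X$ is a factor. Gromov compactification: let $\mathcal U_{w,d}$ be the initial uniformity on $X$ generated by the functions $f_z\colon X\to\mathbb R$, $f_z(x)=d(x,z)$,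 $z\in X$. The Gromov compactification $\gamma\colon X\to\gamma X$ is the Samuel compactification of $(X,\mathcal U_{w,d})$, i.e. the compactification corresponding to the algebra of all bounded $\mathcal U_{w,d}$-uniformly continuous real functions on $X$. (When $G$ acts continuously by isometries, it is an equivariant compactification.) *)

theory Defs
  imports "HOL-Analysis.Analysis" "HOL-Algebra.Group_Action"
begin

section \<open>Metric notions\<close>

definition isometry_group :: "('a::metric_space \<Rightarrow> 'a) monoid" where
  "isometry_group =
     \<lparr>carrier = {f. bij f \<and> (\<forall>x y. dist (f x) (f y) = dist x y)}, mult = (\<circ>), one = id\<rparr>"

definition pointwise_topology :: "('a::topological_space \<Rightarrow> 'a) set \<Rightarrow> ('a \<Rightarrow> 'a) topology" where
  "pointwise_topology G = subtopology (product_topology (\<lambda>_. euclidean) UNIV) G"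

text \<open>The diameter takes values in \<open>[0,\<infinity>]\<close>, unlike the real-valued \<^const>\<open>diameter\<close> of the
  library, which is only meaningful for bounded sets. The diameter of the empty set is \<open>0\<close>.\<close>

definition ediameter :: "'a set \<Rightarrow> ('a \<Rightarrow> 'a \<Rightarrow> real) \<Rightarrow> ennreal" where
  "ediameter M d = (SUP (x, y) \<in> M \<times> M. ennreal (d x y))"

definition isometric_embedding_on ::
    "'b set \<Rightarrow> ('b \<Rightarrow> 'b \<Rightarrow> real) \<Rightarrow> ('b \<Rightarrow> 'a::metric_space) \<Rightarrow> bool" where
  "isometric_embedding_on K d \<phi> \<longleftrightarrow> (\<forall>x\<in>K. \<forall>y\<in>K. dist (\<phi> x) (\<phi> y) = d x y)"

text \<open>Every finite metric space is isometric to one whose points are natural numbers, so it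
  suffices to let \<open>L\<close> range over finite sets of naturals with an arbitrary metric. The metric of
  \<open>K\<close> is the restriction of that of \<open>L\<close>, hence the diameter of \<open>K\<close> is at most that of \<open>L\<close>.\<close>

definition finitely_injective :: "'a::metric_space itself \<Rightarrow> bool" where
  "finitely_injective _ \<longleftrightarrow>
     (\<forall>(K::nat set) L d (\<phi>::nat \<Rightarrow> 'a).
        finite L \<and> Metric_space L d \<and> K \<subseteq> L \<and>
        ediameter L d \<le> ediameter (UNIV::'a set) dist \<and>
        isometric_embedding_on K d \<phi> \<longrightarrow>
        (\<exists>\<Phi>::nat \<Rightarrow> 'a. isometric_embedding_on L d \<Phi> \<and> (\<forall>x\<in>K. \<Phi> x = \<phi> x)))"

definition approx_ultrahomogeneous :: "('a::metric_space \<Rightarrow> 'a) set \<Rightarrow> bool" where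
  "approx_ultrahomogeneous G \<longleftrightarrow>
     (\<forall>\<epsilon>>0. \<forall>A B p. finite A \<and> finite B \<and> bij_betw p A B \<and> isometric_embedding_on A dist p \<longrightarrow>
        (\<exists>g\<in>G. \<forall>a\<in>A. dist (p a) (g a) < \<epsilon>))"


section \<open>Equivariant compactifications\<close>

definition topological_group :: "('g, 'm) monoid_scheme \<Rightarrow> 'g topology \<Rightarrow> bool" where
  "topological_group G T \<longleftrightarrow>
     group G \<and> topspace T = carrier G \<and>
     continuous_map (prod_topology T T) T (\<lambda>(g, h). g \<otimes>\<^bsub>G\<^esub> h) \<and>
     continuous_map T T (\<lambda>g. inv\<^bsub>G\<^esub> g)"

text \<open>The library's \<^const>\<open>group_action\<close> requires \<open>\<alpha> g\<close> to be a bijection of \<open>topspace X\<close> that is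
  undefined elsewhere; the values off \<open>topspace X\<close> carry no information.\<close>

definition G_space ::
    "('g, 'm) monoid_scheme \<Rightarrow> 'g topology \<Rightarrow> 'x topology \<Rightarrow> ('g \<Rightarrow> 'x \<Rightarrow> 'x) \<Rightarrow> bool" where
  "G_space G T X \<alpha> \<longleftrightarrow>
     topological_group G T \<and> completely_regular_space X \<and> Hausdorff_space X \<and>
     group_action G (topspace X) \<alpha> \<and>
     continuous_map (prod_topology T X) X (\<lambda>(g, x). \<alpha> g x)"

text \<open>The action on \<open>K\<close> is quantified existentially; it is unique because \<open>\<nu>\<close> has dense image and
  \<open>K\<close> is Hausdorff.\<close>

definition equivariant_compactification ::
    "('g, 'm) monoid_scheme \<Rightarrow> 'g topology \<Rightarrow> 'x topology \<Rightarrow> ('g \<Rightarrow> 'x \<Rightarrow> 'x) \<Rightarrow>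
     'k topology \<Rightarrow> ('x \<Rightarrow> 'k) \<Rightarrow> bool" where
  "equivariant_compactification G T X \<alpha> K \<nu> \<longleftrightarrow>
     G_space G T X \<alpha> \<and> compact_space K \<and>
     continuous_map X K \<nu> \<and> K closure_of (\<nu> ` topspace X) = topspace K \<and>
     (\<exists>\<kappa>. G_space G T K \<kappa> \<and>
          (\<forall>g\<in>carrier G. \<forall>x\<in>topspace X. \<nu> (\<alpha> g x) = \<kappa> g (\<nu> x)))"

text \<open>\<open>compactification_factor X K \<nu> K' \<nu>'\<close>: the compactification \<open>\<nu>'\<close> is a factor of \<open>\<nu>\<close>.\<close>

definition compactification_factor ::
    "'x topology \<Rightarrow> 'k topology \<Rightarrow> ('x \<Rightarrow> 'k) \<Rightarrow> 'l topology \<Rightarrow> ('x \<Rightarrow> 'l) \<Rightarrow> bool" where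
  "compactification_factor X K \<nu> K' \<nu>' \<longleftrightarrow>
     (\<exists>\<pi>. continuous_map K K' \<pi> \<and> (\<forall>x\<in>topspace X. \<pi> (\<nu> x) = \<nu>' x))"

definition compactification_equivalent ::
    "'x topology \<Rightarrow> 'k topology \<Rightarrow> ('x \<Rightarrow> 'k) \<Rightarrow> 'l topology \<Rightarrow> ('x \<Rightarrow> 'l) \<Rightarrow> bool" where
  "compactification_equivalent X K \<nu> K' \<nu>' \<longleftrightarrow>
     compactification_factor X K \<nu> K' \<nu>' \<and> compactification_factor X K' \<nu>' K \<nu>"

text \<open>Since a formula cannot quantify over types, the type \<open>'k\<close> of the points of the competing
  compactifications is a parameter. For \<open>'k = ('x \<Rightarrow> real) \<Rightarrow> real\<close> nothing is lost: a
  compactification \<open>\<nu>\<close> on any type is equivalent to one on a subspace of a power of the reals, by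
  sending \<open>k\<close> to the family of values \<open>\<phi> k\<close>, indexed by the functions \<open>\<phi> \<circ> \<nu>\<close>, where \<open>\<phi>\<close> ranges
  over the continuous real functions on the compactification.\<close>

definition greatest_equivariant_compactification ::
    "'k itself \<Rightarrow> ('g, 'm) monoid_scheme \<Rightarrow> 'g topology \<Rightarrow> 'x topology \<Rightarrow> ('g \<Rightarrow> 'x \<Rightarrow> 'x) \<Rightarrow>
     'b topology \<Rightarrow> ('x \<Rightarrow> 'b) \<Rightarrow> bool" where
  "greatest_equivariant_compactification _ G T X \<alpha> B \<beta> \<longleftrightarrow>
     equivariant_compactification G T X \<alpha> B \<beta> \<and>
     (\<forall>(K::'k topology) \<nu>. equivariant_compactification G T X \<alpha> K \<nu> \<longrightarrow>
        compactification_factor X B \<beta> K \<nu>)"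


section \<open>The Gromov compactification\<close>

text \<open>Uniformities are represented by their filters of entourages, as in the library's class
  \<^class>\<open>uniform_space\<close>. The class itself is not used for the domain, since it fixes one
  uniformity per type.\<close>

definition initial_uniformity :: "('a \<Rightarrow> 'b::uniform_space) set \<Rightarrow> ('a \<times> 'a) filter" where
  "initial_uniformity F = (INF f\<in>F. filtercomap (map_prod f f) uniformity)"

definition bounded_unif_cont :: "('a \<times> 'a) filter \<Rightarrow> ('a \<Rightarrow> real) set" where
  "bounded_unif_cont U = {f. bounded (range f) \<and> filterlim (map_prod f f) uniformity U}"

text \<open>The compactification corresponding to the algebra \<open>A\<close> of bounded functions is the closure
  of the image of the evaluation map into the product of copies of the reals indexed by \<open>A\<close>.\<close>

definition algebra_map :: "('a \<Rightarrow> real) set \<Rightarrow> 'a \<Rightarrow> ('a \<Rightarrow> real) \<Rightarrow> real" where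
  "algebra_map A x = (\<lambda>f\<in>A. f x)"

definition algebra_space :: "('a \<Rightarrow> real) set \<Rightarrow> (('a \<Rightarrow> real) \<Rightarrow> real) topology" where
  "algebra_space A =
     (let P = product_topology (\<lambda>_. euclideanreal) A
      in subtopology P (P closure_of range (algebra_map A)))"

definition gromov_uniformity :: "('a::metric_space \<times> 'a) filter" where
  "gromov_uniformity = initial_uniformity (range (\<lambda>z x. dist x z))"

definition gromov_space :: "(('a::metric_space \<Rightarrow> real) \<Rightarrow> real) topology" where
  "gromov_space = algebra_space (bounded_unif_cont gromov_uniformity)"

definition gromov_map :: "'a::metric_space \<Rightarrow> ('a \<Rightarrow> real) \<Rightarrow> real" where
  "gromov_map = algebra_map (bounded_unif_cont gromov_uniformity)"

end

theory Submission
  imports Defs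
begin

text \<open>If \<open>\<nu>\<close> is an equivariant compactification and \<open>\<phi>\<close> a continuous function on it, then
  \<open>f = \<phi> \<circ> \<nu>\<close> moves little under a neighbourhood of the identity, given by a finite set \<open>Z\<close> and
  \<open>\<delta> > 0\<close>. If the distances of \<open>x\<close> and \<open>y\<close> to the points of \<open>Z\<close> differ by less than \<open>\<delta> / 2\<close>,
  finite injectivity yields a \<open>\<delta> / 2\<close>-small perturbation \<open>Z'\<close> of \<open>Z\<close> such that \<open>Z \<union> {x}\<close> and
  \<open>Z' \<union> {y}\<close> are isometric, and approximate homogeneity a \<open>g\<close> in that neighbourhood with \<open>g x\<close>
  as close to \<open>y\<close> as continuity of \<open>f\<close> at \<open>y\<close> requires. So \<open>f x\<close> is close to \<open>f y\<close>: every such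
  \<open>f\<close> belongs to the algebra of the Gromov compactification, which is itself equivariant.\<close>

section \<open>Extension of isometries in finitely injective spaces\<close>

text \<open>Finite injectivity is phrased for metrics on sets of naturals. Numbering the classes of
  points at distance 0 reduces a pseudometric on any index type to that form; \<open>\<phi>\<close>
  descends to the classes because it preserves distances into a metric space.\<close>

lemma finitely_injective_pseudometric:
  fixes \<phi> :: "'i \<Rightarrow> 'a::metric_space" and d :: "'i \<Rightarrow> 'i \<Rightarrow> real"
  assumes inj: "finitely_injective TYPE('a)" and fin: "finite L" and KL: "K \<subseteq> L"
    and nonneg: "\<And>u v. 0 \<le> d u v" and refl: "\<And>u. d u u = 0" and sym: "\<And>u v. d u v = d v u"
    and tri: "\<And>u v w. d u w \<le> d u v + d v w"
    and diam: "ediameter L d \<le> ediameter (UNIV::'a set) dist"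
    and iso: "isometric_embedding_on K d \<phi>"
  shows "\<exists>\<Phi>::'i \<Rightarrow> 'a. isometric_embedding_on L d \<Phi> \<and> (\<forall>u\<in>K. \<Phi> u = \<phi> u)"
proof -
  define c where "c u = {v\<in>L. d u v = 0}" for u
  obtain h :: "'i set \<Rightarrow> nat" where h: "inj_on h (c ` L)"
    using finite_imp_inj_to_nat_seg[of "c ` L"] fin by blast
  define r where "r u = h (c u)" for u
  have cong0: "d u w \<le> d v w" if "d u v = 0" for u v w
    using tri[of u w v] that by simp
  have cong: "d u w = d v w" if "d u v = 0" for u v w
    using cong0[of u v w] cong0[of v u w] that sym[of u v] by simp
  have cong2: "d u w = d u' w'" if "d u u' = 0" "d w w' = 0" for u u' w w'
    using cong[OF that(1)] cong[OF that(2)] sym by metis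
  have r_eq: "r u = r v \<longleftrightarrow> d u v = 0" if "u \<in> L" "v \<in> L" for u v
  proof
    assume "r u = r v"
    then have "c u = c v" using h that by (auto simp: r_def dest: inj_onD)
    moreover have "v \<in> c v" using that refl by (simp add: c_def)
    ultimately show "d u v = 0" by (auto simp: c_def)
  next
    assume "d u v = 0"
    then show "r u = r v" using cong[of u v] by (simp add: r_def c_def)
  qed
  \<comment> \<open>A choice of representatives turns \<open>d\<close> into a metric
    \<open>e\<close> on the class numbers; by \<open>cong2\<close> the choice is immaterial.\<close>
  define s where "s = inv_into L r"
  have sL: "s m \<in> L" "r (s m) = m" if "m \<in> r ` L" for m
    using that by (auto simp: s_def inv_into_into f_inv_into_f)
  have sr: "d (s (r u)) u = 0" if "u \<in> L" for u
    using r_eq[of "s (r u)" u] sL[of "r u"] that by auto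
  define e where "e m n = d (s m) (s n)" for m n
  have e_r: "e (r u) (r v) = d u v" if "u \<in> L" "v \<in> L" for u v
    unfolding e_def using cong2 sr that by blast
  have "Metric_space (r ` L) e"
  proof
    show "(e m n = 0) = (m = n)" if "m \<in> r ` L" "n \<in> r ` L" for m n
      using that e_r r_eq by auto
  qed (auto simp: e_def nonneg sym intro: tri)
  moreover have "ediameter (r ` L) e \<le> ediameter (UNIV::'a set) dist"
  proof -
    have "ediameter (r ` L) e \<le> ediameter L d"
      unfolding ediameter_def by (rule SUP_mono) (use e_r in force)
    then show ?thesis using diam by order
  qed
  moreover
  define \<phi>0 where "\<phi>0 = \<phi> \<circ> inv_into K r"
  have \<phi>0: "\<phi>0 (r u) = \<phi> u" if "u \<in> K" for u
  proof -
    define u' where "u' = inv_into K r (r u)"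
    have u': "u' \<in> K" "r u' = r u"
      using that by (auto simp: u'_def inv_into_into f_inv_into_f)
    then have "d u' u = 0" using r_eq that KL by blast
    then have "dist (\<phi> u') (\<phi> u) = 0"
      using iso u' that by (auto simp: isometric_embedding_on_def)
    then show ?thesis by (simp add: \<phi>0_def u'_def)
  qed
  have "isometric_embedding_on (r ` K) e \<phi>0"
    using iso KL e_r \<phi>0 by (auto simp: isometric_embedding_on_def subset_iff)
  moreover have "finite (r ` L)" "r ` K \<subseteq> r ` L" using fin KL by auto
  ultimately obtain \<Phi>0 :: "nat \<Rightarrow> 'a"
    where \<Phi>0: "isometric_embedding_on (r ` L) e \<Phi>0" "\<forall>m\<in>r ` K. \<Phi>0 m = \<phi>0 m"
    using inj unfolding finitely_injective_def by blast
  have "isometric_embedding_on L d (\<Phi>0 \<circ> r)"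
    using \<Phi>0(1) e_r by (auto simp: isometric_embedding_on_def)
  moreover have "\<forall>u\<in>K. (\<Phi>0 \<circ> r) u = \<phi> u" using \<Phi>0(2) \<phi>0 by simp
  ultimately show ?thesis by blast
qed

text \<open>A copy of \<open>u\<close> and a copy of \<open>v\<close> are glued along the index
  \<open>p\<close>, and the embedding \<open>v\<close> of the second copy is extended to the whole.
  The image of the first copy is \<open>w\<close>; it stays near \<open>v\<close> because
  corresponding points of the two copies are at distance at most \<open>\<delta>\<close>.\<close>

lemma finitely_injective_perturb:
  fixes u v :: "'i \<Rightarrow> 'a::metric_space"
  assumes inj: "finitely_injective TYPE('a)" and fin: "finite I" and p: "p \<in> I"
    and same: "\<And>i j. i \<in> I - {p} \<Longrightarrow> j \<in> I - {p} \<Longrightarrow> dist (u i) (u j) = dist (v i) (v j)"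
    and near: "\<And>i. i \<in> I \<Longrightarrow> \<bar>dist (u i) (u p) - dist (v i) (v p)\<bar> \<le> \<delta>"
  shows "\<exists>w. isometric_embedding_on I (\<lambda>i j. dist (u i) (u j)) w \<and> w p = v p \<and>
             (\<forall>i\<in>I. dist (w i) (v i) \<le> \<delta>)"
proof -
  let ?D = "ediameter (UNIV::'a set) dist"
  \<comment> \<open>\<open>True\<close> marks the copy of \<open>u\<close>, \<open>False\<close>
    that of \<open>v\<close>.\<close>
  define P where "P b i = (if b then u i else v i)" for b i
  \<comment> \<open>The functions \<open>F k\<close> are distance functions on each of the two copies, shifted so that they
    agree at \<open>p\<close>; the pseudometric they induce glues the copies along \<open>p\<close>.\<close>
  define F where "F k s = dist (P (snd s) k) (P (snd s) (fst s)) - dist (P (snd s) k) (P (snd s) p)"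
    for k and s :: "'i \<times> bool"
  define \<rho> where "\<rho> s t = Max ((\<lambda>k. \<bar>F k s - F k t\<bar>) ` I)" for s t
  \<comment> \<open>Truncation at the diameter of the space secures the diameter condition of finite
    injectivity. Distances inside one copy never exceed the diameter, so they survive.\<close>
  define d where "d s t = enn2real (min (ennreal (\<rho> s t)) ?D)" for s t
  have \<rho>_ge: "\<bar>F k s - F k t\<bar> \<le> \<rho> s t" if "k \<in> I" for k s t
    unfolding \<rho>_def using fin that by (intro Max_ge) auto
  have \<rho>_le: "\<rho> s t \<le> c" if "\<And>k. k \<in> I \<Longrightarrow> \<bar>F k s - F k t\<bar> \<le> c" for s t c
    unfolding \<rho>_def using fin p that by (subst Max_le_iff) auto
  have \<rho>0: "0 \<le> \<rho> s t" for s t using \<rho>_ge[OF p, of s t] by linarith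
  have \<rho>_refl: "\<rho> s s = 0" for s using \<rho>_le[of s s 0] \<rho>0[of s s] by simp
  have \<rho>_sym: "\<rho> s t = \<rho> t s" for s t by (simp add: \<rho>_def abs_minus_commute)
  have \<rho>_tri: "\<rho> s w \<le> \<rho> s t + \<rho> t w" for s t w
  proof (rule \<rho>_le)
    fix k assume "k \<in> I"
    then show "\<bar>F k s - F k w\<bar> \<le> \<rho> s t + \<rho> t w"
      using \<rho>_ge[of k s t] \<rho>_ge[of k t w] by linarith
  qed
  \<comment> \<open>As in the Kuratowski embedding: the shifts cancel within a copy, the triangle
    inequality bounds every coordinate, and the coordinate \<open>k = i\<close> attains the
    distance.\<close>
  have \<rho>_copy: "\<rho> (i, b) (j, b) = dist (P b i) (P b j)" if "i \<in> I" "j \<in> I" for i j b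
  proof (rule antisym)
    show "\<rho> (i, b) (j, b) \<le> dist (P b i) (P b j)"
      using abs_dist_diff_le[of "P b i" _ "P b j"]
      by (intro \<rho>_le) (simp add: F_def dist_commute[of _ "P b i"])
    show "dist (P b i) (P b j) \<le> \<rho> (i, b) (j, b)"
      using \<rho>_ge[OF that(1), of "(i, b)" "(j, b)"] by (simp add: F_def)
  qed
  have ennd: "ennreal (d s t) = min (ennreal (\<rho> s t)) ?D" for s t
    unfolding d_def
    by (rule ennreal_enn2real) (rule le_less_trans[OF min.cobounded1 ennreal_less_top])
  have d_le: "d s t \<le> \<rho> s t" for s t
  proof -
    have "ennreal (d s t) \<le> ennreal (\<rho> s t)" unfolding ennd by simp
    then show ?thesis using \<rho>0 by simp
  qed
  have d_copy: "d (i, b) (j, b) = dist (P b i) (P b j)" if "i \<in> I" "j \<in> I" for i j b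
  proof -
    have "ennreal (dist (P b i) (P b j)) \<le> ?D"
      unfolding ediameter_def
      by (rule SUP_upper2[of "(P b i, P b j)"]) auto
    then show ?thesis by (simp add: d_def \<rho>_copy[OF that] min_absorb1)
  qed
  have d0: "0 \<le> d s t" for s t by (simp add: d_def)
  \<comment> \<open>If a summand on the right is truncated, it alone reaches the diameter; otherwise
    the right side is the untruncated sum.\<close>
  have d_tri: "d s w \<le> d s t + d t w" for s t w
  proof -
    have "ennreal (d s w) \<le> min (ennreal (\<rho> s t) + ennreal (\<rho> t w)) ?D"
      unfolding ennd using \<rho>_tri[of s w t] \<rho>0
      by (intro min.mono) (auto simp flip: ennreal_plus)
    also have "\<dots> \<le> min (ennreal (\<rho> s t)) ?D + min (ennreal (\<rho> t w)) ?D"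
    proof (cases "?D \<le> ennreal (\<rho> s t) \<or> ?D \<le> ennreal (\<rho> t w)")
      case True
      then show ?thesis
        by (auto simp: min_absorb2 intro!: min.coboundedI2 intro: add_increasing add_increasing2)
    qed (auto simp: min_absorb1)
    also have "\<dots> = ennreal (d s t + d t w)" by (simp add: ennd d0)
    finally show ?thesis
      using d0[of s t] d0[of t w] by (subst (asm) ennreal_le_iff) auto
  qed
  have "\<exists>\<Phi>. isometric_embedding_on (I \<times> UNIV) d \<Phi> \<and> (\<forall>s\<in>I \<times> {False}. \<Phi> s = (v \<circ> fst) s)"
  proof (rule finitely_injective_pseudometric[OF inj])
    show "d s s = 0" for s using d_le[of s s] d0[of s s] \<rho>_refl by simp
    show "d s t = d t s" for s t by (simp add: d_def \<rho>_sym)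
    show "ediameter (I \<times> UNIV) d \<le> ?D"
      unfolding ediameter_def[of "I \<times> UNIV"] by (rule SUP_least) (auto simp: ennd)
    show "isometric_embedding_on (I \<times> {False}) d (v \<circ> fst)"
      using d_copy by (auto simp: isometric_embedding_on_def P_def)
  qed (use fin d0 d_tri in auto)
  then obtain \<Phi> where \<Phi>: "\<And>s t. s \<in> I \<times> UNIV \<Longrightarrow> t \<in> I \<times> UNIV \<Longrightarrow> dist (\<Phi> s) (\<Phi> t) = d s t"
      and \<Phi>v: "\<And>i. i \<in> I \<Longrightarrow> \<Phi> (i, False) = v i"
    unfolding isometric_embedding_on_def by fastforce
  define w where "w i = \<Phi> (i, True)" for i
  have "isometric_embedding_on I (\<lambda>i j. dist (u i) (u j)) w"
    using \<Phi> d_copy[of _ _ True] by (simp add: isometric_embedding_on_def w_def P_def)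
  moreover have wv: "dist (w i) (v i) \<le> \<rho> (i, True) (i, False)" if "i \<in> I" for i
    using \<Phi>[of "(i, True)" "(i, False)"] \<Phi>v that d_le[of "(i, True)" "(i, False)"]
    by (simp add: w_def)
  \<comment> \<open>Every \<open>F k\<close> vanishes at both copies of \<open>p\<close>, so the
    gluing identifies them.\<close>
  have "\<rho> (p, True) (p, False) \<le> 0" by (rule \<rho>_le) (simp add: F_def)
  then have "w p = v p" using wv[OF p] by (smt (verit) dist_le_zero_iff)
  moreover have "dist (w i) (v i) \<le> \<delta>" if i: "i \<in> I" for i
  proof -
    have "0 \<le> \<delta>" using near[OF p] by simp
    \<comment> \<open>For \<open>i = p\<close> both values are 0; for \<open>k = p\<close> only the
      distances to \<open>p\<close> are compared. In the remaining case the distances between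
      \<open>k\<close> and \<open>i\<close> cancel by \<open>same\<close>, and the shifts differ by
      at most \<open>\<delta>\<close> by \<open>near\<close>.\<close>
    have "\<rho> (i, True) (i, False) \<le> \<delta>"
    proof (rule \<rho>_le)
      fix k assume k: "k \<in> I"
      show "\<bar>F k (i, True) - F k (i, False)\<bar> \<le> \<delta>"
      proof (cases "i = p")
        case True
        then show ?thesis using \<open>0 \<le> \<delta>\<close> by (simp add: F_def)
      next
        case False
        show ?thesis
        proof (cases "k = p")
          case True
          then show ?thesis using near[OF i] by (simp add: F_def P_def dist_commute)
        next
          case False
          then show ?thesis using near[OF k] same[of k i] \<open>i \<noteq> p\<close> i k
            by (simp add: F_def P_def)
        qed
      qed
    qed
    then show ?thesis using wv[OF i] by linarith
  qed
  ultimately show ?thesis by blast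
qed

text \<open>The value \<open>f (g x)\<close> is compared with \<open>f x\<close> by almost
  invariance and with \<open>f y\<close> by continuity, each within half of
  \<open>\<epsilon>\<close>. Since \<open>g\<close> is chosen after \<open>y\<close>, continuity at
  \<open>y\<close> can prescribe how close \<open>g x\<close> has to be.\<close>

lemma motion_bounded_imp_near:
  fixes f :: "'a::metric_space \<Rightarrow> real"
  assumes inj: "finitely_injective TYPE('a)" and hom: "approx_ultrahomogeneous G"
    and cont: "continuous_on UNIV f" and Z: "finite Z" and \<delta>: "0 < \<delta>" and \<epsilon>: "0 < \<epsilon>"
    and f: "\<And>g x. g \<in> G \<Longrightarrow> (\<And>z. z \<in> Z \<Longrightarrow> dist (g z) z < \<delta>) \<Longrightarrow> \<bar>f (g x) - f x\<bar> < \<epsilon> / 2"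
    and xy: "\<And>z. z \<in> Z \<Longrightarrow> \<bar>dist x z - dist y z\<bar> < \<delta> / 2"
  shows "\<bar>f x - f y\<bar> < \<epsilon>"
proof -
  \<comment> \<open>\<open>None\<close> indexes the point that changes from \<open>x\<close> to
    \<open>y\<close>; the points of \<open>Z\<close> keep indices of their own even if
    \<open>x\<close> or \<open>y\<close> lies in \<open>Z\<close>.\<close>
  define I where "I = insert None (Some ` Z)"
  define u where "u i = (case i of None \<Rightarrow> x | Some z \<Rightarrow> z)" for i
  define v where "v i = (case i of None \<Rightarrow> y | Some z \<Rightarrow> z)" for i
  have "\<exists>w. isometric_embedding_on I (\<lambda>i j. dist (u i) (u j)) w \<and> w None = v None \<and>
             (\<forall>i\<in>I. dist (w i) (v i) \<le> \<delta> / 2)"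
  proof (rule finitely_injective_perturb[OF inj])
    show "\<bar>dist (u i) (u None) - dist (v i) (v None)\<bar> \<le> \<delta> / 2" if "i \<in> I" for i
      using that xy \<delta> by (auto simp: I_def u_def v_def dist_commute less_imp_le)
  qed (use Z in \<open>auto simp: I_def u_def v_def\<close>)
  then obtain w where "isometric_embedding_on I (\<lambda>i j. dist (u i) (u j)) w"
      and wy: "w None = y" and wv: "\<And>i. i \<in> I \<Longrightarrow> dist (w i) (v i) \<le> \<delta> / 2"
    by (auto simp: v_def)
  then have w: "dist (w i) (w j) = dist (u i) (u j)" if "i \<in> I" "j \<in> I" for i j
    using that by (simp add: isometric_embedding_on_def)
  \<comment> \<open>The partial isometry carries \<open>u i\<close> to \<open>w i\<close>. Choosing
    an index for a point is harmless: where \<open>u\<close> repeats a value, so does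
    \<open>w\<close>.\<close>
  define p where "p = w \<circ> inv_into I u"
  have p: "p (u i) = w i" if "i \<in> I" for i
  proof -
    have "inv_into I u (u i) \<in> I" "u (inv_into I u (u i)) = u i"
      using that by (auto simp: inv_into_into f_inv_into_f)
    then have "dist (p (u i)) (w i) = 0" using w that by (simp add: p_def)
    then show ?thesis by simp
  qed
  have iso: "isometric_embedding_on (u ` I) dist p"
    using p w by (auto simp: isometric_embedding_on_def)
  have "inj_on p (u ` I)"
  proof (rule inj_onI)
    fix a b assume "a \<in> u ` I" "b \<in> u ` I" "p a = p b"
    then have "dist a b = 0" using iso by (force simp: isometric_embedding_on_def)
    then show "a = b" by simp
  qed
  then have bij: "bij_betw p (u ` I) (p ` u ` I)" by (rule inj_on_imp_bij_betw)
  obtain \<eta> where \<eta>: "0 < \<eta>" "\<And>y'. dist y' y < \<eta> \<Longrightarrow> dist (f y') (f y) < \<epsilon> / 2"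
    using cont half_gt_zero[OF \<epsilon>] unfolding continuous_on_iff by blast
  \<comment> \<open>The bound \<open>\<eta>\<close> brings \<open>g x\<close> close enough to
    \<open>y\<close>. The bound \<open>\<delta> / 2\<close> adds to the displacement of
    \<open>w\<close> from \<open>Z\<close>, so that \<open>g\<close> moves the points of
    \<open>Z\<close> by less than \<open>\<delta>\<close>.\<close>
  have "finite (u ` I)" "finite (p ` u ` I)" "0 < min \<eta> (\<delta> / 2)" using Z \<eta> \<delta> by (auto simp: I_def)
  then have "\<exists>g\<in>G. \<forall>a\<in>u ` I. dist (p a) (g a) < min \<eta> (\<delta> / 2)"
    using hom iso bij unfolding approx_ultrahomogeneous_def by blast
  then obtain g where g: "g \<in> G"
      and gu: "\<And>i. i \<in> I \<Longrightarrow> dist (w i) (g (u i)) < min \<eta> (\<delta> / 2)"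
    using p by auto
  have "dist (g z) z < \<delta>" if "z \<in> Z" for z
    using gu[of "Some z"] wv[of "Some z"] that dist_triangle2[of "g z" z "w (Some z)"]
      dist_triangle3[of "g z" z "w (Some z)"]
    by (simp add: I_def u_def v_def)
  then have "\<bar>f (g x) - f x\<bar> < \<epsilon> / 2" by (rule f[OF g])
  moreover have "dist (f (g x)) (f y) < \<epsilon> / 2"
    using gu[of None] wy by (intro \<eta>(2)) (simp add: I_def u_def dist_commute)
  ultimately show ?thesis unfolding dist_real_def by linarith
qed


section \<open>Compactifications from algebras of functions\<close>

lemma continuous_map_into_metric:
  fixes f :: "'x \<Rightarrow> 'a::metric_space"
  shows "continuous_map X euclidean f \<longleftrightarrow>
    (\<forall>x\<in>topspace X. \<forall>\<epsilon>>0. \<exists>U. openin X U \<and> x \<in> U \<and> (\<forall>y\<in>U. dist (f x) (f y) < \<epsilon>))"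
  using Met_TC.continuous_map_to_metric[of X f] by simp

lemma topspace_algebra_space:
  "topspace (algebra_space A) =
     product_topology (\<lambda>_. euclideanreal) A closure_of range (algebra_map A)"
  by (simp add: algebra_space_def Let_def Int_absorb1 closure_of_subset_topspace
      del: topspace_product_topology)

lemma algebra_map_in_space: "algebra_map A x \<in> topspace (algebra_space A)"
  unfolding topspace_algebra_space
  by (rule subsetD[OF closure_of_subset]) (auto simp: algebra_map_def)

lemma algebra_map_dense: "algebra_space A closure_of range (algebra_map A) = topspace (algebra_space A)"
proof -
  have "range (algebra_map A) \<subseteq> topspace (algebra_space A)"
    using algebra_map_in_space by (rule image_subsetI)
  then show ?thesis
    unfolding topspace_algebra_space
    by (simp add: algebra_space_def Let_def closure_of_subtopology Int_absorb1)
qed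

lemma continuous_map_algebra_eval: "f \<in> A \<Longrightarrow> continuous_map (algebra_space A) euclideanreal (\<lambda>q. q f)"
  unfolding algebra_space_def Let_def
  by (intro continuous_map_from_subtopology continuous_map_product_projection)

lemma algebra_space_extensional: "q \<in> topspace (algebra_space A) \<Longrightarrow> q \<in> extensional A"
  by (auto simp: algebra_space_def Let_def PiE_def)

lemma continuous_map_into_algebra_space:
  assumes "\<And>f. f \<in> A \<Longrightarrow> continuous_map X euclideanreal (\<lambda>x. h x f)"
    and "h ` topspace X \<subseteq> topspace (algebra_space A)"
  shows "continuous_map X (algebra_space A) h"
proof -
  have "h ` topspace X \<subseteq> extensional A" using assms(2) algebra_space_extensional by blast
  with assms have "continuous_map X (product_topology (\<lambda>_. euclideanreal) A) h"
    by (simp add: continuous_map_componentwise)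
  then show ?thesis
    using assms(2) unfolding topspace_algebra_space
    by (auto simp: algebra_space_def Let_def continuous_map_in_subtopology)
qed

text \<open>Density of the image of the evaluation map, in the form in which it is used: a closed
  condition has to be checked only at points of the original space.\<close>

lemma algebra_space_closed_induct:
  assumes "q \<in> topspace (algebra_space A)"
    and "closedin (algebra_space A) {q \<in> topspace (algebra_space A). P q}"
    and "\<And>x. P (algebra_map A x)"
  shows "P q"
proof -
  have "algebra_space A closure_of range (algebra_map A) \<subseteq> {q \<in> topspace (algebra_space A). P q}"
    using assms algebra_map_in_space by (intro closure_of_minimal) auto
  then show ?thesis using assms(1) by (auto simp: algebra_map_dense)
qed

text \<open>Evaluations satisfy the bound, and it is a closed condition. It makes every point of the
  compactification nonexpansive for the supremum distance, which later yields joint continuity of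
  the action.\<close>

lemma algebra_space_diff_le:
  assumes q: "q \<in> topspace (algebra_space A)" and "f \<in> A" "h \<in> A" and "\<And>x. \<bar>f x - h x\<bar> \<le> c"
  shows "\<bar>q f - q h\<bar> \<le> c"
proof (rule algebra_space_closed_induct[OF q])
  have "continuous_map (algebra_space A) euclideanreal (\<lambda>q. \<bar>q f - q h\<bar>)"
    using assms by (intro continuous_map_real_abs continuous_map_diff continuous_map_algebra_eval)
  from closedin_continuous_map_preimage[OF this, of "{..c}"]
  show "closedin (algebra_space A) {q \<in> topspace (algebra_space A). \<bar>q f - q h\<bar> \<le> c}"
    by simp
qed (use assms in \<open>simp add: algebra_map_def\<close>)

lemma Hausdorff_algebra_space: "Hausdorff_space (algebra_space A)"
  unfolding algebra_space_def Let_def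
  by (intro Hausdorff_space_subtopology) (simp add: Hausdorff_space_product_topology)

text \<open>The closure is a closed subset of a product of compact intervals, compact by Tychonoff's
  theorem.\<close>

lemma compact_algebra_space:
  assumes "\<And>f. f \<in> A \<Longrightarrow> bounded (range f)"
  shows "compact_space (algebra_space A)"
proof -
  let ?P = "product_topology (\<lambda>_. euclideanreal) A"
  obtain b where b: "\<And>f x. f \<in> A \<Longrightarrow> \<bar>f x\<bar> \<le> b f"
    using assms unfolding bounded_iff by (metis rangeI real_norm_def)
  have b': "- b f \<le> f x" "f x \<le> b f" if "f \<in> A" for f x
    using b[OF that, of x] by linarith+
  define B where "B = PiE A (\<lambda>f. {- b f..b f})"
  have cpt: "compactin ?P B" by (simp add: B_def compactin_PiE)
  have "range (algebra_map A) \<subseteq> B"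
    using b' by (auto simp: B_def algebra_map_def)
  moreover have "closedin ?P B" using cpt
    by (intro compactin_imp_closedin) (auto simp: Hausdorff_space_product_topology)
  ultimately have "?P closure_of range (algebra_map A) \<subseteq> B" by (rule closure_of_minimal)
  then have "compactin ?P (?P closure_of range (algebra_map A))"
    using cpt closed_compactin closedin_closure_of by blast
  then show ?thesis
    by (simp add: algebra_space_def Let_def compact_space_subtopology)
qed

lemma compact_Hausdorff_imp_completely_regular_space:
  "compact_space X \<Longrightarrow> Hausdorff_space X \<Longrightarrow> completely_regular_space X"
  using compact_Hausdorff_or_regular_imp_normal_space normal_imp_completely_regular_space by blast

text \<open>\<open>E\<close> embeds \<open>K\<close> into the power of the reals indexed by its
  continuous functions. \<open>S\<close> reads the coordinate \<open>\<phi> \<circ> \<nu>\<close> at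
  the index \<open>\<phi>\<close> and lands in this copy of \<open>K\<close>; the factor map is
  \<open>S\<close> followed by the inverse of \<open>E\<close>.\<close>

lemma algebra_space_factor:
  fixes \<nu> :: "'a::topological_space \<Rightarrow> 'k"
  assumes K: "compact_space K" "Hausdorff_space K" and \<nu>: "\<And>x. \<nu> x \<in> topspace K"
    and A: "\<And>\<phi>. continuous_map K euclideanreal \<phi> \<Longrightarrow> \<phi> \<circ> \<nu> \<in> A"
  shows "compactification_factor euclidean (algebra_space A) (algebra_map A) K \<nu>"
proof -
  define C where "C = {\<phi>. continuous_map K euclideanreal \<phi>}"
  define P where "P = product_topology (\<lambda>_. euclideanreal) C"
  define E where "E k = (\<lambda>\<phi>\<in>C. \<phi> k)" for k
  define S where "S q = (\<lambda>\<phi>\<in>C. q (\<phi> \<circ> \<nu>))" for q :: "('a \<Rightarrow> real) \<Rightarrow> real"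
  have P2: "Hausdorff_space P" by (simp add: P_def Hausdorff_space_product_topology)
  have contE: "continuous_map K P E"
    by (auto simp: P_def E_def C_def continuous_map_componentwise)
  \<comment> \<open>Complete regularity of a compact Hausdorff space provides a continuous function
    separating two distinct points.\<close>
  have inj: "inj_on E (topspace K)"
  proof (rule inj_onI, rule ccontr)
    fix k l assume k: "k \<in> topspace K" "l \<in> topspace K" "E k = E l" "k \<noteq> l"
    have "closedin K {l}" using K k by (simp add: closedin_Hausdorff_singleton)
    then obtain \<phi> where "continuous_map K euclideanreal \<phi>" "\<phi> k = 0" "\<phi> ` {l} \<subseteq> {1}"
      using compact_Hausdorff_imp_completely_regular_space[OF K] k
      unfolding completely_regular_space_alt by (metis Diff_iff singletonD)
    moreover from this(1) have "\<phi> k = \<phi> l"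
      using fun_cong[OF k(3), of \<phi>] by (simp add: E_def C_def)
    ultimately show False by simp
  qed
  have "embedding_map K P E"
    using contE K P2 inj by (intro continuous_imp_embedding_map)
  then obtain E' where E': "homeomorphic_maps K (subtopology P (E ` topspace K)) E E'"
    by (auto simp: embedding_map_def homeomorphic_map_maps)
  have contS0: "continuous_map (algebra_space A) P S"
    by (auto simp: P_def S_def C_def continuous_map_componentwise intro!: continuous_map_algebra_eval A)
  have S\<nu>: "S (algebra_map A x) = E (\<nu> x)" for x
    using A by (auto simp: S_def E_def C_def algebra_map_def restrict_def)
  \<comment> \<open>The copy of \<open>K\<close> is compact, hence closed in the Hausdorff space
    \<open>P\<close>, so by density only the points where \<open>S\<close> is given by
    \<open>E\<close> and \<open>\<nu>\<close> need checking.\<close>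
  have "S q \<in> E ` topspace K" if "q \<in> topspace (algebra_space A)" for q
  proof (rule algebra_space_closed_induct[OF that])
    have "closedin P (E ` topspace K)"
      using image_compactin[OF _ contE] K P2 compactin_imp_closedin unfolding compact_space_def by blast
    then show "closedin (algebra_space A) {q \<in> topspace (algebra_space A). S q \<in> E ` topspace K}"
      by (rule closedin_continuous_map_preimage[OF contS0])
  qed (use S\<nu> \<nu> in auto)
  then have "continuous_map (algebra_space A) (subtopology P (E ` topspace K)) S"
    using contS0 by (auto simp: continuous_map_in_subtopology)
  then have "continuous_map (algebra_space A) K (E' \<circ> S)"
    using E' continuous_map_compose by (auto simp: homeomorphic_maps_def)
  moreover have "(E' \<circ> S) (algebra_map A x) = \<nu> x" for x
    using E' \<nu> S\<nu> by (auto simp: homeomorphic_maps_def)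
  ultimately show ?thesis unfolding compactification_factor_def by blast
qed

section \<open>Groups of isometries\<close>

abbreviation isometry_subgroup :: "('a::metric_space \<Rightarrow> 'a) set \<Rightarrow> ('a \<Rightarrow> 'a) monoid" where
  "isometry_subgroup G \<equiv> isometry_group\<lparr>carrier := G\<rparr>"

lemma group_isometry_group: "group isometry_group"
proof (rule groupI)
  fix g :: "'a \<Rightarrow> 'a" assume "g \<in> carrier isometry_group"
  then have g: "bij g" "\<And>x y. dist (g x) (g y) = dist x y" by (auto simp: isometry_group_def)
  define h where "h = inv_into UNIV g"
  have gh: "g (h x) = x" "h (g x) = x" for x
    using g(1) by (simp_all add: h_def bij_is_surj bij_is_inj surj_f_inv_f)
  have "dist (h x) (h y) = dist x y" for x y
    using g(2)[of "h x" "h y"] by (simp add: gh)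
  moreover have "bij h" using gh by (intro o_bij[of g]) (auto simp: fun_eq_iff)
  ultimately show "\<exists>h\<in>carrier isometry_group. h \<otimes>\<^bsub>isometry_group\<^esub> g = \<one>\<^bsub>isometry_group\<^esub>"
    using gh by (intro bexI[of _ h]) (auto simp: isometry_group_def)
qed (auto simp: isometry_group_def bij_comp comp_assoc)

lemma isometry_subgroup_facts:
  assumes "subgroup G isometry_group"
  shows group_isometry_subgroup: "group (isometry_subgroup G)"
    and isometry_subgroup_id: "id \<in> G"
    and isometry_subgroup_comp: "\<And>g h. g \<in> G \<Longrightarrow> h \<in> G \<Longrightarrow> g \<circ> h \<in> G"
    and isometry_subgroup_bij: "\<And>g. g \<in> G \<Longrightarrow> bij g"
    and isometry_subgroup_dist: "\<And>g x y. g \<in> G \<Longrightarrow> dist (g x) (g y) = dist x y"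
proof -
  show "group (isometry_subgroup G)"
    using assms group_isometry_group by (rule subgroup.subgroup_is_group)
  show "id \<in> G" using subgroup.one_closed[OF assms] by (simp add: isometry_group_def)
  show "g \<circ> h \<in> G" if "g \<in> G" "h \<in> G" for g h
    using subgroup.m_closed[OF assms that] by (simp add: isometry_group_def)
  show "bij g" "dist (g x) (g y) = dist x y" if "g \<in> G" for g x y
    using subgroup.subset[OF assms] that by (auto simp: isometry_group_def)
qed

lemma isometry_subgroup_inv:
  assumes "subgroup G isometry_group" and g: "g \<in> G"
  shows "inv\<^bsub>isometry_subgroup G\<^esub> g \<in> G"
    and "g ((inv\<^bsub>isometry_subgroup G\<^esub> g) x) = x"
    and "(inv\<^bsub>isometry_subgroup G\<^esub> g) (g x) = x"
proof -
  interpret group "isometry_subgroup G" using assms(1) by (rule group_isometry_subgroup)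
  show "inv\<^bsub>isometry_subgroup G\<^esub> g \<in> G" using inv_closed[of g] g by simp
  show "g ((inv\<^bsub>isometry_subgroup G\<^esub> g) x) = x" "(inv\<^bsub>isometry_subgroup G\<^esub> g) (g x) = x"
    using r_inv[of g] l_inv[of g] g by (auto simp: isometry_group_def fun_eq_iff)
qed

section \<open>Pointwise convergence and the action on the space\<close>

lemma topspace_pointwise_topology [simp]: "topspace (pointwise_topology G) = G"
  by (simp add: pointwise_topology_def)

lemma continuous_map_pointwise_apply: "continuous_map (pointwise_topology G) euclidean (\<lambda>g. g x)"
  unfolding pointwise_topology_def
  by (intro continuous_map_from_subtopology continuous_map_product_projection) simp

lemma continuous_map_into_pointwise:
  assumes "h ` topspace X \<subseteq> G" and "\<And>x. continuous_map X euclidean (\<lambda>t. h t x)"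
  shows "continuous_map X (pointwise_topology G) h"
  using assms unfolding pointwise_topology_def
  by (auto simp: continuous_map_in_subtopology continuous_map_componentwise_UNIV)

lemma openin_pointwise_topology_ball:
  fixes G :: "('a::metric_space \<Rightarrow> 'a) set"
  assumes "finite Z"
  shows "openin (pointwise_topology G) {g \<in> G. \<forall>z\<in>Z. dist (h z) (g z) < \<delta>}"
  using assms
proof (induction Z)
  case empty
  show ?case using openin_topspace[of "pointwise_topology G"] by simp
next
  case (insert z Z)
  have "openin (pointwise_topology G) {g \<in> topspace (pointwise_topology G). g z \<in> ball (h z) \<delta>}"
    by (rule openin_continuous_map_preimage[OF continuous_map_pointwise_apply]) simp
  from openin_Int[OF this insert.IH]
  show ?case by (rule back_subst) auto
qed

text \<open>A basic open set of the product restricts only finitely many coordinates, so one radius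
  serves for all of them. Together with \<open>openin_pointwise_topology_ball\<close> this describes
  a neighbourhood base at \<open>h\<close>.\<close>

lemma pointwise_topology_nhd:
  fixes G :: "('a::metric_space \<Rightarrow> 'a) set"
  assumes "openin (pointwise_topology G) U" and "h \<in> U"
  obtains Z \<delta> where "finite Z" "0 < \<delta>" "{g \<in> G. \<forall>z\<in>Z. dist (h z) (g z) < \<delta>} \<subseteq> U"
proof -
  obtain S where S: "openin (product_topology (\<lambda>_. euclidean) UNIV) S" "U = S \<inter> G"
    using assms(1) by (auto simp: pointwise_topology_def openin_subtopology)
  then have "h \<in> S" using assms(2) by simp
  with S(1) obtain V where V: "finite {i. V i \<noteq> UNIV}" "\<And>i. open (V i)" "h \<in> PiE UNIV V"
      "PiE UNIV V \<subseteq> S"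
    unfolding openin_product_topology_alt by auto
  have "\<exists>r>0. ball (h i) r \<subseteq> V i" for i
    using V(2,3) open_contains_ball by blast
  then obtain r where r: "\<And>i. 0 < r i" "\<And>i. ball (h i) (r i) \<subseteq> V i" by metis
  define Z where "Z = {i. V i \<noteq> UNIV}"
  \<comment> \<open>The inserted 1 gives the minimum a value when \<open>Z\<close> is empty.\<close>
  define \<delta> where "\<delta> = Min (insert 1 (r ` Z))"
  have Z: "finite Z" using V by (simp add: Z_def)
  have \<delta>: "0 < \<delta>" "\<And>z. z \<in> Z \<Longrightarrow> \<delta> \<le> r z" using Z r by (auto simp: \<delta>_def)
  have "g \<in> U" if "g \<in> G" and near: "\<forall>z\<in>Z. dist (h z) (g z) < \<delta>" for g
  proof -
    have "g i \<in> V i" for i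
    proof (cases "i \<in> Z")
      case True
      then have "g i \<in> ball (h i) (r i)" using near \<delta>(2)[of i] by force
      then show ?thesis using r by blast
    qed (simp add: Z_def)
    then show ?thesis using V(4) S(2) that by (auto simp: PiE_iff)
  qed
  then show thesis using that[OF Z \<delta>(1)] by blast
qed

text \<open>Near \<open>(h, x)\<close> it is enough to control \<open>g\<close> at the single point
  \<open>x\<close>, because the isometry \<open>g\<close> does not enlarge the distance from
  \<open>x\<close> to a nearby point.\<close>

lemma continuous_map_isometry_apply:
  assumes "subgroup G isometry_group"
  shows "continuous_map (prod_topology (pointwise_topology G) euclidean) euclidean (\<lambda>(g, x). g x)"
  unfolding continuous_map_into_metric
proof clarsimp
  fix h :: "'a \<Rightarrow> 'a" and x :: 'a and \<epsilon> :: real assume h: "h \<in> G" and "0 < \<epsilon>"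
  define U where "U = {g \<in> G. \<forall>z\<in>{x}. dist (h z) (g z) < \<epsilon> / 2} \<times> ball x (\<epsilon> / 2)"
  have "openin (prod_topology (pointwise_topology G) euclidean) U"
    unfolding U_def
    by (intro openin_prod_Times_iff[THEN iffD2] disjI2 conjI openin_pointwise_topology_ball) auto
  moreover have "(h, x) \<in> U" using h \<open>0 < \<epsilon>\<close> by (simp add: U_def)
  moreover have "dist (h x) (g y) < \<epsilon>" if "(g, y) \<in> U" for g y
    using that isometry_subgroup_dist[OF assms, of g x y] dist_triangle[of "h x" "g y" "g x"]
    by (auto simp: U_def)
  ultimately show "\<exists>U. openin (prod_topology (pointwise_topology G) euclidean) U \<and> (h, x) \<in> U \<and>
      (\<forall>y\<in>U. dist (h x) (case y of (g, x) \<Rightarrow> g x) < \<epsilon>)"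
    by (intro exI[of _ U]) auto
qed

text \<open>Composition is handled by joint continuity of evaluation, since
  \<open>(g \<circ> h) x\<close> is \<open>g (h x)\<close>. Inversion is handled by applying the
  isometry \<open>g\<close> to the two preimages of \<open>x\<close>.\<close>

lemma topological_group_isometries:
  assumes sub: "subgroup G isometry_group"
  shows "topological_group (isometry_subgroup G) (pointwise_topology G)"
proof -
  let ?T = "pointwise_topology G"
  have "continuous_map (prod_topology ?T ?T) ?T (\<lambda>(g, h). g \<circ> h)"
  proof (rule continuous_map_into_pointwise)
    show "(\<lambda>(g, h). g \<circ> h) ` topspace (prod_topology ?T ?T) \<subseteq> G"
      using isometry_subgroup_comp[OF sub] by auto
    fix x
    have "continuous_map (prod_topology ?T ?T) euclidean ((\<lambda>g. g x) \<circ> snd)"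
      using continuous_map_snd continuous_map_pointwise_apply by (rule continuous_map_compose)
    then have "continuous_map (prod_topology ?T ?T) (prod_topology ?T euclidean) (\<lambda>t. (fst t, snd t x))"
      by (intro continuous_map_pairedI) (simp_all add: continuous_map_fst comp_def)
    from continuous_map_compose[OF this continuous_map_isometry_apply[OF sub]]
    show "continuous_map (prod_topology ?T ?T) euclidean (\<lambda>t. (case t of (g, h) \<Rightarrow> g \<circ> h) x)"
      by (simp add: comp_def case_prod_unfold)
  qed
  moreover have "continuous_map ?T ?T (\<lambda>g. inv\<^bsub>isometry_subgroup G\<^esub> g)"
  proof (rule continuous_map_into_pointwise)
    fix x
    let ?i = "\<lambda>g. inv\<^bsub>isometry_subgroup G\<^esub> g"
    show "continuous_map ?T euclidean (\<lambda>g. ?i g x)"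
      unfolding continuous_map_into_metric
    proof clarsimp
      fix h and \<epsilon> :: real assume h: "h \<in> G" and "0 < \<epsilon>"
      \<comment> \<open>The test point is the preimage of \<open>x\<close> under \<open>h\<close>:
        there \<open>h\<close> takes the value \<open>x\<close>, and \<open>g\<close> misses
        \<open>x\<close> by exactly the distance between the two preimages.\<close>
      define U where "U = {g \<in> G. \<forall>z\<in>{?i h x}. dist (h z) (g z) < \<epsilon>}"
      have "openin ?T U" unfolding U_def by (rule openin_pointwise_topology_ball) simp
      moreover have "h \<in> U" using h \<open>0 < \<epsilon>\<close> by (simp add: U_def)
      moreover have "dist (?i h x) (?i g x) < \<epsilon>" if "g \<in> U" for g
      proof -
        have "dist (?i h x) (?i g x) = dist (g (?i h x)) (g (?i g x))"
          using that isometry_subgroup_dist[OF sub] by (simp add: U_def)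
        also have "\<dots> = dist (h (?i h x)) (g (?i h x))"
          using isometry_subgroup_inv(2)[OF sub h] isometry_subgroup_inv(2)[OF sub, of g] that
          by (simp add: U_def dist_commute)
        finally show ?thesis using that by (simp add: U_def)
      qed
      ultimately show "\<exists>U. openin ?T U \<and> h \<in> U \<and> (\<forall>g\<in>U. dist (?i h x) (?i g x) < \<epsilon>)"
        by blast
    qed
  qed (use isometry_subgroup_inv[OF sub] in auto)
  ultimately show ?thesis
    using group_isometry_subgroup[OF sub]
    by (simp add: topological_group_def isometry_group_def)
qed

lemma G_space_isometries:
  fixes G :: "('a::metric_space \<Rightarrow> 'a) set"
  assumes sub: "subgroup G isometry_group"
  shows "G_space (isometry_subgroup G) (pointwise_topology G) euclidean (\<lambda>g. g)"
proof -
  have "(\<lambda>g. g) \<in> hom (isometry_subgroup G) (BijGroup UNIV)"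
    using isometry_subgroup_bij[OF sub]
    by (auto simp: hom_def BijGroup_def Bij_def isometry_group_def compose_def fun_eq_iff)
  then have "group_action (isometry_subgroup G) UNIV (\<lambda>g. g)"
    using group_isometry_subgroup[OF sub] group_BijGroup
    by (simp add: group_action_def group_hom_def group_hom_axioms_def)
  moreover have "completely_regular_space (euclidean :: 'a topology)"
    by (simp add: metrizable_imp_completely_regular_space metrizable_space_euclidean)
  ultimately show ?thesis
    using topological_group_isometries[OF sub] continuous_map_isometry_apply[OF sub]
    by (simp add: G_space_def)
qed

text \<open>The action on the compactification is dual to composition, and \<open>invar\<close>
  keeps it inside the index set. By \<open>equi\<close>, \<open>f \<circ> g\<close> depends
  continuously on \<open>g\<close> in the supremum distance; this makes the extended action jointly
  continuous.\<close>

lemma equivariant_compactification_algebra: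
  fixes G :: "('a::metric_space \<Rightarrow> 'a) set"
  assumes sub: "subgroup G isometry_group"
    and bdd: "\<And>f. f \<in> A \<Longrightarrow> bounded (range f)"
    and cont: "\<And>f. f \<in> A \<Longrightarrow> continuous_on UNIV f"
    and invar: "\<And>f g. f \<in> A \<Longrightarrow> g \<in> G \<Longrightarrow> f \<circ> g \<in> A"
    and equi: "\<And>f h \<epsilon>. f \<in> A \<Longrightarrow> h \<in> G \<Longrightarrow> 0 < \<epsilon> \<Longrightarrow>
      \<exists>U. openin (pointwise_topology G) U \<and> h \<in> U \<and> (\<forall>g\<in>U. \<forall>x. \<bar>f (h x) - f (g x)\<bar> < \<epsilon>)"
  shows "equivariant_compactification (isometry_subgroup G) (pointwise_topology G) euclidean (\<lambda>g. g)
           (algebra_space A) (algebra_map A)"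
proof -
  let ?T = "pointwise_topology G"
  let ?E = "algebra_space A"
  \<comment> \<open>The outer restriction meets the convention that group actions are undefined off
    the space, the inner one the convention for points of a product.\<close>
  define act where "act g = (\<lambda>q\<in>topspace ?E. \<lambda>f\<in>A. q (f \<circ> g))" for g :: "'a \<Rightarrow> 'a"
  have act_map: "act g (algebra_map A x) = algebra_map A (g x)" if "g \<in> G" for g x
    using invar[OF _ that] algebra_map_in_space[of A x]
    by (auto simp: act_def algebra_map_def restrict_def)
  \<comment> \<open>The map is continuous into the full product, where the compactification is
    closed; on the dense image it is given by \<open>act_map\<close>.\<close>
  have act_space: "act g q \<in> topspace ?E" if g: "g \<in> G" and q: "q \<in> topspace ?E" for g q
  proof (rule algebra_space_closed_induct[OF q])
    let ?P = "product_topology (\<lambda>_. euclideanreal) A"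
    have "continuous_map ?E ?P (\<lambda>q. \<lambda>f\<in>A. q (f \<circ> g))"
      using invar[OF _ g]
      by (auto simp: continuous_map_componentwise intro!: continuous_map_algebra_eval)
    then have "continuous_map ?E ?P (act g)"
      by (rule continuous_map_eq) (simp add: act_def)
    then show "closedin ?E {q \<in> topspace ?E. act g q \<in> topspace ?E}"
      by (rule closedin_continuous_map_preimage) (simp add: topspace_algebra_space)
  qed (simp add: act_map g algebra_map_in_space)
  have act_eval: "act g q f = q (f \<circ> g)" if "q \<in> topspace ?E" "f \<in> A" for g q f
    using that by (simp add: act_def)
  have act_comp: "act g (act h q) = act (g \<circ> h) q"
    if "g \<in> G" "h \<in> G" and q: "q \<in> topspace ?E" for g h q
  proof (rule extensionalityI[of _ A])
    show "act g (act h q) \<in> extensional A" "act (g \<circ> h) q \<in> extensional A"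
      using that act_space isometry_subgroup_comp[OF sub] algebra_space_extensional by blast+
    show "act g (act h q) f = act (g \<circ> h) q f" if "f \<in> A" for f
      using that act_space[OF \<open>h \<in> G\<close> q] q invar[OF that \<open>g \<in> G\<close>] by (simp add: act_eval comp_assoc)
  qed
  have act_id: "act id q = q" if q: "q \<in> topspace ?E" for q
    using act_space[OF isometry_subgroup_id[OF sub] q] q
    by (intro extensionalityI[of _ A]) (auto simp: act_eval dest: algebra_space_extensional)
  have act_Bij: "act g \<in> Bij (topspace ?E)" if g: "g \<in> G" for g
  proof -
    let ?h = "inv\<^bsub>isometry_subgroup G\<^esub> g"
    have h: "?h \<in> G" "g \<circ> ?h = id" "?h \<circ> g = id"
      using isometry_subgroup_inv[OF sub g] by (auto simp: fun_eq_iff)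
    have "bij_betw (act g) (topspace ?E) (topspace ?E)"
      by (rule bij_betw_byWitness[of _ "act ?h"])
        (auto simp: act_comp g h act_id intro: act_space)
    then show ?thesis by (simp add: Bij_def act_def)
  qed
  have "act (g \<circ> h) = compose (topspace ?E) (act g) (act h)" if "g \<in> G" "h \<in> G" for g h
    by (rule extensionalityI[of _ "topspace ?E"])
      (use that act_comp in \<open>auto simp: compose_eq compose_def act_def[of "g \<circ> h"]\<close>)
  then have "act \<in> hom (isometry_subgroup G) (BijGroup (topspace ?E))"
    using act_Bij by (auto simp: hom_def BijGroup_def isometry_group_def)
  then have "group_action (isometry_subgroup G) (topspace ?E) act"
    using group_isometry_subgroup[OF sub] group_BijGroup
    by (simp add: group_action_def group_hom_def group_hom_axioms_def)
  moreover have "continuous_map (prod_topology ?T ?E) ?E (\<lambda>(g, q). act g q)"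
  proof (rule continuous_map_into_algebra_space)
    fix f assume f: "f \<in> A"
    show "continuous_map (prod_topology ?T ?E) euclideanreal (\<lambda>t. (case t of (g, q) \<Rightarrow> act g q) f)"
      unfolding continuous_map_into_metric
    proof clarsimp
      fix h p and \<epsilon> :: real assume h: "h \<in> G" and p: "p \<in> topspace ?E" and "0 < \<epsilon>"
      then obtain U where U: "openin ?T U" "h \<in> U" "\<And>g x. g \<in> U \<Longrightarrow> \<bar>f (h x) - f (g x)\<bar> < \<epsilon> / 2"
        using equi[OF f h, of "\<epsilon> / 2"] by auto
      \<comment> \<open>The change is split at \<open>q (f \<circ> h)\<close>: \<open>W\<close>
        controls the step from \<open>p\<close> to \<open>q\<close> with \<open>h\<close> fixed, and
        \<open>U\<close> controls the step from \<open>h\<close> to \<open>g\<close> uniformly in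
        \<open>q\<close>.\<close>
      define W where "W = {q \<in> topspace ?E. q (f \<circ> h) \<in> ball (p (f \<circ> h)) (\<epsilon> / 2)}"
      have "openin ?E W" unfolding W_def
        by (rule openin_continuous_map_preimage[OF continuous_map_algebra_eval[OF invar[OF f h]]]) simp
      then have "openin (prod_topology ?T ?E) (U \<times> W)" using U by (simp add: openin_prod_Times_iff)
      moreover have "(h, p) \<in> U \<times> W" using U p \<open>0 < \<epsilon>\<close> by (simp add: W_def)
      moreover have "dist (act h p f) (act g q f) < \<epsilon>" if "g \<in> U" "q \<in> W" for g q
      proof -
        have q: "q \<in> topspace ?E" "dist (p (f \<circ> h)) (q (f \<circ> h)) < \<epsilon> / 2"
          using that by (auto simp: W_def)
        have "g \<in> G" using openin_subset[OF U(1)] that by auto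
        then have "\<bar>q (f \<circ> h) - q (f \<circ> g)\<bar> \<le> \<epsilon> / 2"
          using U(3)[OF that(1)]
          by (intro algebra_space_diff_le[OF q(1) invar[OF f h] invar[OF f]]) (simp_all add: less_imp_le)
        moreover have "act h p f = p (f \<circ> h)" "act g q f = q (f \<circ> g)"
          using p q(1) f by (simp_all add: act_eval)
        ultimately show ?thesis using q(2) unfolding dist_real_def by linarith
      qed
      ultimately show "\<exists>U. openin (prod_topology ?T ?E) U \<and> (h, p) \<in> U \<and>
          (\<forall>t\<in>U. dist (act h p f) ((case t of (g, q) \<Rightarrow> act g q) f) < \<epsilon>)"
        by (intro exI[of _ "U \<times> W"]) auto
    qed
  qed (use act_space in auto)
  moreover have "compact_space ?E" using bdd by (rule compact_algebra_space)
  ultimately have "G_space (isometry_subgroup G) ?T ?E act"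
    using topological_group_isometries[OF sub] Hausdorff_algebra_space[of A]
    by (simp add: G_space_def compact_Hausdorff_imp_completely_regular_space)
  moreover have "continuous_map euclidean ?E (algebra_map A)"
    using cont algebra_map_in_space
    by (intro continuous_map_into_algebra_space) (auto simp: algebra_map_def)
  ultimately show ?thesis
    using G_space_isometries[OF sub] \<open>compact_space ?E\<close> act_map
    by (auto simp: equivariant_compactification_def algebra_map_dense)
qed


section \<open>The Gromov compactification\<close>

text \<open>Membership in an infimum of filters involves only finitely many of them, and the
  smallest of finitely many radii can replace them all.\<close>

lemma eventually_gromov_uniformity:
  "eventually P (gromov_uniformity :: ('a::metric_space \<times> 'a) filter) \<longleftrightarrow>
    (\<exists>Z \<delta>. finite Z \<and> 0 < \<delta> \<and> (\<forall>x y. (\<forall>z\<in>Z. \<bar>dist x z - dist y z\<bar> < \<delta>) \<longrightarrow> P (x, y)))"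
  (is "?L \<longleftrightarrow> ?R")
proof -
  let ?F = "\<lambda>z. filtercomap (map_prod (\<lambda>x::'a. dist x z) (\<lambda>x. dist x z)) uniformity"
  have ev: "eventually Q (?F z) \<longleftrightarrow> (\<exists>\<delta>>0. \<forall>x y. \<bar>dist x z - dist y z\<bar> < \<delta> \<longrightarrow> Q (x, y))" for Q z
  proof
    assume "eventually Q (?F z)"
    then show "\<exists>\<delta>>0. \<forall>x y. \<bar>dist x z - dist y z\<bar> < \<delta> \<longrightarrow> Q (x, y)"
      by (fastforce simp: eventually_filtercomap eventually_uniformity_metric dist_real_def)
  next
    assume "\<exists>\<delta>>0. \<forall>x y. \<bar>dist x z - dist y z\<bar> < \<delta> \<longrightarrow> Q (x, y)"
    then obtain \<delta> where "0 < \<delta>" "\<forall>x y. \<bar>dist x z - dist y z\<bar> < \<delta> \<longrightarrow> Q (x, y)" by blast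
    then show "eventually Q (?F z)"
      unfolding eventually_filtercomap eventually_uniformity_metric
      by (intro exI[of _ "\<lambda>(s, t). \<bar>s - t\<bar> < \<delta>"]) (auto simp: dist_real_def)
  qed
  have gu: "gromov_uniformity = (INF z. ?F z)"
    by (simp add: gromov_uniformity_def initial_uniformity_def image_comp)
  show ?thesis
  proof
    assume ?L
    then have "\<exists>Z\<subseteq>UNIV. finite Z \<and> eventually P (INF z\<in>Z. ?F z)"
      unfolding gu by (rule eventually_INF[THEN iffD1])
    then obtain Z where Z: "finite Z" "eventually P (INF z\<in>Z. ?F z)" by blast
    then obtain Q where Q: "\<And>z. z \<in> Z \<Longrightarrow> eventually (Q z) (?F z)" "\<And>t. (\<forall>z\<in>Z. Q z t) \<Longrightarrow> P t"
      unfolding eventually_INF_finite[OF Z(1)] by blast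
    then have "\<exists>r. \<forall>z\<in>Z. 0 < r z \<and> (\<forall>x y. \<bar>dist x z - dist y z\<bar> < r z \<longrightarrow> Q z (x, y))"
      unfolding ev by (intro bchoice) blast
    then obtain r where r: "\<And>z. z \<in> Z \<Longrightarrow> 0 < r z"
        "\<And>z x y. z \<in> Z \<Longrightarrow> \<bar>dist x z - dist y z\<bar> < r z \<Longrightarrow> Q z (x, y)" by blast
    define \<delta> where "\<delta> = Min (insert 1 (r ` Z))"
    have \<delta>: "0 < \<delta>" "\<And>z. z \<in> Z \<Longrightarrow> \<delta> \<le> r z" using Z r by (auto simp: \<delta>_def)
    have "P (x, y)" if "\<forall>z\<in>Z. \<bar>dist x z - dist y z\<bar> < \<delta>" for x y
    proof (rule Q(2), intro ballI r(2))
      show "\<bar>dist x z - dist y z\<bar> < r z" if "z \<in> Z" for z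
        using that \<delta>(2)[OF that] \<open>\<forall>z\<in>Z. \<bar>dist x z - dist y z\<bar> < \<delta>\<close> by fastforce
    qed
    then show ?R using Z(1) \<delta>(1) by blast
  next
    assume ?R
    then obtain Z \<delta> where Z: "finite Z" "0 < \<delta>"
      "\<And>x y. (\<forall>z\<in>Z. \<bar>dist x z - dist y z\<bar> < \<delta>) \<Longrightarrow> P (x, y)" by blast
    have "eventually P (INF z\<in>Z. ?F z)"
      unfolding eventually_INF_finite[OF Z(1)] ev
      by (rule exI[of _ "\<lambda>z (x, y). \<bar>dist x z - dist y z\<bar> < \<delta>"]) (use Z in auto)
    then show ?L unfolding gu by (intro eventually_INF[THEN iffD2]) (use Z(1) in blast)
  qed
qed

lemma mem_gromov_algebra:
  fixes f :: "'a::metric_space \<Rightarrow> real"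
  shows "f \<in> bounded_unif_cont gromov_uniformity \<longleftrightarrow> bounded (range f) \<and>
    (\<forall>\<epsilon>>0. \<exists>Z \<delta>. finite Z \<and> 0 < \<delta> \<and>
       (\<forall>x y. (\<forall>z\<in>Z. \<bar>dist x z - dist y z\<bar> < \<delta>) \<longrightarrow> \<bar>f x - f y\<bar> < \<epsilon>))"
proof -
  have "filterlim (map_prod f f) uniformity gromov_uniformity \<longleftrightarrow>
      (\<forall>\<epsilon>>0. eventually (\<lambda>t. \<bar>f (fst t) - f (snd t)\<bar> < \<epsilon>) gromov_uniformity)" (is "?L \<longleftrightarrow> ?R")
  proof
    assume L: ?L
    show ?R
    proof (intro allI impI)
      fix \<epsilon> :: real assume "0 < \<epsilon>"
      then have "eventually (\<lambda>t. dist (fst t) (snd t) < \<epsilon>) (uniformity :: (real \<times> real) filter)"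
        unfolding eventually_uniformity_metric by auto
      from eventually_compose_filterlim[OF this L]
      show "eventually (\<lambda>t. \<bar>f (fst t) - f (snd t)\<bar> < \<epsilon>) gromov_uniformity"
        by (simp add: dist_real_def)
    qed
  next
    assume R: ?R
    show ?L unfolding filterlim_iff
    proof (intro allI impI)
      fix P :: "real \<times> real \<Rightarrow> bool" assume "eventually P uniformity"
      then obtain \<epsilon> where \<epsilon>: "0 < \<epsilon>" "\<And>s t. \<bar>s - t\<bar> < \<epsilon> \<Longrightarrow> P (s, t)"
        by (auto simp: eventually_uniformity_metric dist_real_def)
      with R have "eventually (\<lambda>t. \<bar>f (fst t) - f (snd t)\<bar> < \<epsilon>) gromov_uniformity" by blast
      then show "eventually (\<lambda>t. P (map_prod f f t)) gromov_uniformity"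
        by (rule eventually_mono) (simp add: \<epsilon> map_prod_def split_beta)
    qed
  qed
  then show ?thesis by (simp add: bounded_unif_cont_def eventually_gromov_uniformity)
qed

lemma gromov_algebraE:
  fixes f :: "'a::metric_space \<Rightarrow> real"
  assumes "f \<in> bounded_unif_cont gromov_uniformity" and "0 < \<epsilon>"
  obtains Z \<delta> where "finite Z" "0 < \<delta>"
    "\<forall>x y. (\<forall>z\<in>Z. \<bar>dist x z - dist y z\<bar> < \<delta>) \<longrightarrow> \<bar>f x - f y\<bar> < \<epsilon>"
proof -
  have "\<exists>Z \<delta>. finite Z \<and> 0 < \<delta> \<and>
      (\<forall>x y. (\<forall>z\<in>Z. \<bar>dist x z - dist y z\<bar> < \<delta>) \<longrightarrow> \<bar>f x - f y\<bar> < \<epsilon>)"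
    using assms by (simp only: mem_gromov_algebra)
  then show thesis using that by blast
qed

text \<open>Distance functions are nonexpansive, so points closer than \<open>\<delta>\<close>
  satisfy the constraints for every finite set \<open>Z\<close>.\<close>

lemma gromov_algebra_continuous:
  fixes f :: "'a::metric_space \<Rightarrow> real"
  assumes "f \<in> bounded_unif_cont gromov_uniformity"
  shows "continuous_on UNIV f"
  unfolding continuous_on_iff
proof (intro ballI allI impI)
  fix x and \<epsilon> :: real assume "0 < \<epsilon>"
  obtain Z \<delta> where Z: "finite Z" "0 < \<delta>"
    "\<forall>y x. (\<forall>z\<in>Z. \<bar>dist y z - dist x z\<bar> < \<delta>) \<longrightarrow> \<bar>f y - f x\<bar> < \<epsilon>"
    by (rule gromov_algebraE[OF assms \<open>0 < \<epsilon>\<close>])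
  have "dist (f y) (f x) < \<epsilon>" if "dist y x < \<delta>" for y
    unfolding dist_real_def
  proof (rule Z(3)[rule_format])
    show "\<bar>dist y z - dist x z\<bar> < \<delta>" for z
      using that abs_dist_diff_le[of y z x] by (simp add: dist_commute)
  qed
  then show "\<exists>\<delta>>0. \<forall>y\<in>UNIV. dist y x < \<delta> \<longrightarrow> dist (f y) (f x) < \<epsilon>" using Z(2) by blast
qed

text \<open>An isometry can be moved from the argument to the reference point: the distance of
  \<open>g x\<close> to \<open>z\<close> is that of \<open>x\<close> to the preimage of
  \<open>z\<close>. Thus composition with \<open>g\<close> only replaces \<open>Z\<close> by its
  preimage, and the dependence on \<open>g\<close> is controlled at finitely many points, uniformly
  in \<open>x\<close>.\<close>

lemma equivariant_compactification_gromov: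
  fixes G :: "('a::metric_space \<Rightarrow> 'a) set"
  assumes sub: "subgroup G isometry_group"
  shows "equivariant_compactification (isometry_subgroup G) (pointwise_topology G) euclidean (\<lambda>g. g)
           gromov_space gromov_map"
  unfolding gromov_space_def gromov_map_def
proof (rule equivariant_compactification_algebra[OF sub])
  let ?i = "\<lambda>g. inv\<^bsub>isometry_subgroup G\<^esub> g"
  have shift: "dist (g x) z = dist x (?i g z)" if "g \<in> G" for g x z
    using isometry_subgroup_dist[OF sub that, of x "?i g z"] isometry_subgroup_inv(2)[OF sub that]
    by simp
  fix f :: "'a \<Rightarrow> real" assume f: "f \<in> bounded_unif_cont gromov_uniformity"
  show "bounded (range f)" using f by (simp add: mem_gromov_algebra)
  show "continuous_on UNIV f" using f by (rule gromov_algebra_continuous)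
  show "f \<circ> g \<in> bounded_unif_cont gromov_uniformity" if g: "g \<in> G" for g
    unfolding mem_gromov_algebra
  proof (intro conjI allI impI)
    show "bounded (range (f \<circ> g))"
      using f by (auto simp: mem_gromov_algebra intro: bounded_subset)
    fix \<epsilon> :: real assume "0 < \<epsilon>"
    obtain Z \<delta> where Z: "finite Z" "0 < \<delta>"
      "\<forall>x y. (\<forall>z\<in>Z. \<bar>dist x z - dist y z\<bar> < \<delta>) \<longrightarrow> \<bar>f x - f y\<bar> < \<epsilon>"
      by (rule gromov_algebraE[OF f \<open>0 < \<epsilon>\<close>])
    then show "\<exists>Z \<delta>. finite Z \<and> 0 < \<delta> \<and>
       (\<forall>x y. (\<forall>z\<in>Z. \<bar>dist x z - dist y z\<bar> < \<delta>) \<longrightarrow> \<bar>(f \<circ> g) x - (f \<circ> g) y\<bar> < \<epsilon>)"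
      by (intro exI[of _ "?i g ` Z"] exI[of _ \<delta>]) (simp add: shift[OF g])
  qed
  fix h and \<epsilon> :: real assume h: "h \<in> G" and "0 < \<epsilon>"
  obtain Z \<delta> where Z: "finite Z" "0 < \<delta>"
    "\<forall>x y. (\<forall>z\<in>Z. \<bar>dist x z - dist y z\<bar> < \<delta>) \<longrightarrow> \<bar>f x - f y\<bar> < \<epsilon>"
    by (rule gromov_algebraE[OF f \<open>0 < \<epsilon>\<close>])
  \<comment> \<open>At the \<open>h\<close>-preimage of \<open>z\<close>, \<open>h\<close> takes the
    value \<open>z\<close>; hence the condition says that \<open>g\<close> sends this preimage close
    to \<open>z\<close>.\<close>
  define U where "U = {g \<in> G. \<forall>z\<in>?i h ` Z. dist (h z) (g z) < \<delta>}"
  have "openin (pointwise_topology G) U"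
    unfolding U_def using Z(1) by (intro openin_pointwise_topology_ball) simp
  moreover have "h \<in> U" using h Z(2) by (simp add: U_def)
  moreover have "\<bar>f (h x) - f (g x)\<bar> < \<epsilon>" if "g \<in> U" for g x
  proof (rule Z(3)[rule_format])
    fix z assume "z \<in> Z"
    have g: "g \<in> G" "dist z (g (?i h z)) < \<delta>"
      using that \<open>z \<in> Z\<close> isometry_subgroup_inv(2)[OF sub h] by (auto simp: U_def)
    \<comment> \<open>Both \<open>h\<close> and \<open>g\<close> preserve the distance from
      \<open>x\<close> to the \<open>h\<close>-preimage of \<open>z\<close>, which brings both terms
      to distances from \<open>g x\<close>.\<close>
    have "\<bar>dist (h x) z - dist (g x) z\<bar> = \<bar>dist (g x) (g (?i h z)) - dist (g x) z\<bar>"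
      using shift[OF h] isometry_subgroup_dist[OF sub g(1)] by simp
    also have "\<dots> \<le> dist z (g (?i h z))"
      using abs_dist_diff_le[of "g (?i h z)" "g x" z] by (simp add: dist_commute)
    finally show "\<bar>dist (h x) z - dist (g x) z\<bar> < \<delta>" using g(2) by simp
  qed
  ultimately show "\<exists>U. openin (pointwise_topology G) U \<and> h \<in> U \<and>
      (\<forall>g\<in>U. \<forall>x. \<bar>f (h x) - f (g x)\<bar> < \<epsilon>)" by blast
qed

text \<open>Compactness of \<open>K\<close> makes the motion of \<open>\<phi>\<close> small
  uniformly over \<open>K\<close> for all \<open>g\<close> near the identity. Pulled back along
  \<open>\<nu>\<close>, this is the almost invariance required by
  \<open>motion_bounded_imp_near\<close>.\<close>

lemma compactification_function_in_gromov_algebra: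
  fixes G :: "('a::metric_space \<Rightarrow> 'a) set"
  assumes sub: "subgroup G isometry_group"
    and inj: "finitely_injective TYPE('a)" and hom: "approx_ultrahomogeneous G"
    and comp: "equivariant_compactification (isometry_subgroup G) (pointwise_topology G) euclidean
      (\<lambda>g. g) K \<nu>"
    and \<phi>: "continuous_map K euclideanreal \<phi>"
  shows "\<phi> \<circ> \<nu> \<in> bounded_unif_cont gromov_uniformity"
  unfolding mem_gromov_algebra
proof (intro conjI allI impI)
  let ?T = "pointwise_topology G"
  from comp obtain \<kappa> where K: "compact_space K" and \<nu>: "continuous_map euclidean K \<nu>"
    and \<kappa>: "G_space (isometry_subgroup G) ?T K \<kappa>"
    and equiv: "\<And>g x. g \<in> G \<Longrightarrow> \<nu> (g x) = \<kappa> g (\<nu> x)"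
    by (auto simp: equivariant_compactification_def)
  have \<nu>K: "\<nu> x \<in> topspace K" for x using continuous_map_funspace[OF \<nu>] by auto
  have "compactin euclideanreal (\<phi> ` topspace K)"
    using K \<phi> image_compactin unfolding compact_space_def by blast
  then have "bounded (\<phi> ` topspace K)" by (simp add: compact_imp_bounded)
  then show "bounded (range (\<phi> \<circ> \<nu>))" by (rule bounded_subset) (use \<nu>K in auto)
  have "continuous_map euclidean euclideanreal (\<phi> \<circ> \<nu>)" using \<nu> \<phi> by (rule continuous_map_compose)
  then have cont: "continuous_on UNIV (\<phi> \<circ> \<nu>)" by simp
  fix \<epsilon> :: real assume "0 < \<epsilon>"
  \<comment> \<open>Pairs for which the action changes the value of \<open>\<phi>\<close> by less
    than \<open>\<epsilon> / 2\<close>; the slice over the identity is all of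
    \<open>K\<close>.\<close>
  define W where "W = {t \<in> topspace (prod_topology ?T K).
    \<bar>\<phi> (case t of (g, k) \<Rightarrow> \<kappa> g k) - \<phi> (snd t)\<bar> \<in> {..<\<epsilon> / 2}}"
  have "continuous_map (prod_topology ?T K) K (\<lambda>(g, k). \<kappa> g k)"
    using \<kappa> by (simp add: G_space_def)
  from continuous_map_compose[OF this \<phi>] continuous_map_compose[OF continuous_map_snd \<phi>]
  have "continuous_map (prod_topology ?T K) euclideanreal
      (\<lambda>t. \<bar>\<phi> (case t of (g, k) \<Rightarrow> \<kappa> g k) - \<phi> (snd t)\<bar>)"
    unfolding comp_def by (intro continuous_map_real_abs continuous_map_diff)
  then have W: "openin (prod_topology ?T K) W"
    unfolding W_def by (rule openin_continuous_map_preimage) simp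
  have "\<kappa> id k = k" if "k \<in> topspace K" for k
    using group_action.id_eq_one[of "isometry_subgroup G" "topspace K" \<kappa>] \<kappa> that
    by (auto simp: G_space_def isometry_group_def fun_eq_iff restrict_def split: if_splits)
  then have idW: "{id} \<times> topspace K \<subseteq> W"
    using isometry_subgroup_id[OF sub] \<open>0 < \<epsilon>\<close> by (auto simp: W_def)
  \<comment> \<open>By the tube lemma one neighbourhood \<open>U\<close> of the identity works for
    all points of the compact space \<open>K\<close>.\<close>
  obtain U V where UV: "openin ?T U" "id \<in> U" "topspace K \<subseteq> V" "U \<times> V \<subseteq> W"
    using tube_lemma_right[OF W _ _ idW] K isometry_subgroup_id[OF sub]
    by (auto simp: compact_space_def)
  obtain Z \<delta> where Z: "finite Z" "0 < \<delta>" "{g \<in> G. \<forall>z\<in>Z. dist (id z) (g z) < \<delta>} \<subseteq> U"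
    by (rule pointwise_topology_nhd[OF UV(1,2)])
  have small: "\<bar>(\<phi> \<circ> \<nu>) (g x) - (\<phi> \<circ> \<nu>) x\<bar> < \<epsilon> / 2"
    if "g \<in> G" "\<And>z. z \<in> Z \<Longrightarrow> dist (g z) z < \<delta>" for g x
  proof -
    have "g \<in> U" using Z(3) that by (auto simp: dist_commute)
    then have "(g, \<nu> x) \<in> W" using UV \<nu>K by blast
    then show ?thesis using equiv[OF that(1)] by (simp add: W_def)
  qed
  have "\<bar>(\<phi> \<circ> \<nu>) x - (\<phi> \<circ> \<nu>) y\<bar> < \<epsilon>" if "\<forall>z\<in>Z. \<bar>dist x z - dist y z\<bar> < \<delta> / 2" for x y
    by (rule motion_bounded_imp_near[OF inj hom cont Z(1,2) \<open>0 < \<epsilon>\<close>]) (use small that in auto)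
  then show "\<exists>Z \<delta>. finite Z \<and> 0 < \<delta> \<and>
      (\<forall>x y. (\<forall>z\<in>Z. \<bar>dist x z - dist y z\<bar> < \<delta>) \<longrightarrow> \<bar>(\<phi> \<circ> \<nu>) x - (\<phi> \<circ> \<nu>) y\<bar> < \<epsilon>)"
    using Z half_gt_zero by blast
qed

text \<open>The Gromov algebra contains all functions pulled back from an equivariant
  compactification, so \<open>algebra_space_factor\<close> provides the factor map.\<close>

lemma greatest_equivariant_compactification_gromov:
  fixes G :: "('a::metric_space \<Rightarrow> 'a) set"
  assumes sub: "subgroup G isometry_group"
    and inj: "finitely_injective TYPE('a)" and hom: "approx_ultrahomogeneous G"
  shows "greatest_equivariant_compactification TYPE('k) (isometry_subgroup G) (pointwise_topology G)
    euclidean (\<lambda>g. g) gromov_space gromov_map"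
  unfolding greatest_equivariant_compactification_def
proof (intro conjI allI impI)
  show "equivariant_compactification (isometry_subgroup G) (pointwise_topology G) euclidean (\<lambda>g. g)
      gromov_space gromov_map"
    using sub by (rule equivariant_compactification_gromov)
  fix K :: "'k topology" and \<nu>
  assume comp: "equivariant_compactification (isometry_subgroup G) (pointwise_topology G) euclidean
    (\<lambda>g. g) K \<nu>"
  then have "compact_space K" "Hausdorff_space K" "continuous_map euclidean K \<nu>"
    by (auto simp: equivariant_compactification_def G_space_def)
  then show "compactification_factor euclidean gromov_space gromov_map K \<nu>"
    unfolding gromov_space_def gromov_map_def
    using compactification_function_in_gromov_algebra[OF sub inj hom comp] continuous_map_funspace
    by (intro algebra_space_factor) fastforce+
qed

theorem theorem3p5:
  fixes G :: "('a::metric_space \<Rightarrow> 'a) set"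
  assumes "subgroup G isometry_group"
    and "finitely_injective TYPE('a)"
    and "approx_ultrahomogeneous G"
  shows "greatest_equivariant_compactification TYPE('k)
           (isometry_group\<lparr>carrier := G\<rparr>) (pointwise_topology G) euclidean (\<lambda>g. g)
           (gromov_space :: (('a \<Rightarrow> real) \<Rightarrow> real) topology) gromov_map
       \<and> (\<forall>(B::'b topology) \<beta>.
           greatest_equivariant_compactification TYPE(('a \<Rightarrow> real) \<Rightarrow> real)
             (isometry_group\<lparr>carrier := G\<rparr>) (pointwise_topology G) euclidean (\<lambda>g. g) B \<beta>
           \<longrightarrow> compactification_equivalent euclidean B \<beta> gromov_space gromov_map)"
proof (intro conjI allI impI)
  fix B :: "'b topology" and \<beta>
  assume "greatest_equivariant_compactification TYPE(('a \<Rightarrow> real) \<Rightarrow> real)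
    (isometry_subgroup G) (pointwise_topology G) euclidean (\<lambda>g. g) B \<beta>"
  \<comment> \<open>Each compactification competes against the other: the points of
    \<open>gromov_space\<close> have the type over which \<open>B\<close> is greatest, and the
    greatest property of \<open>gromov_space\<close> is taken at the type of the points of
    \<open>B\<close>.\<close>
  then show "compactification_equivalent euclidean B \<beta> gromov_space gromov_map"
    using greatest_equivariant_compactification_gromov[OF assms, where 'k = 'b]
    unfolding greatest_equivariant_compactification_def compactification_equivalent_def by blast
qed (rule greatest_equivariant_compactification_gromov[OF assms])

end
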